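(* Let $(T,\Sigma,\mu)$ be a complete finite measure space and let $E$ be an infinite-dimensional separable real Banach space with norm dual $E^*$. Suppose that $$\int_T\Gamma(t)\,d\mu=\int_T\mathrm{ex}\,\overline{\mathrm{co}}^{\,w^*}\Gamma(t)\,d\mu$$ holds for every integrably bounded, weakly$^*$ closed-valued multifunction $\Gamma:T\twoheadrightarrow E^*$ with $\mathrm{gph}\,\Gamma\in\Sigma\otimes\mathrm{Borel}(E^*,w^* )$. Then $(T,\Sigma,\mu)$ is saturated.
   Context: A finite measure space $(T,\Sigma,\mu)$ is saturated if for every $S\in\Sigma$ with $\mu(S)>0$ the space $L^1_S(\mu)$ of $\mu$-integrable functions on $(S,\Sigma_S)$, $\Sigma_S=\{A\cap S: A\in\Sigma\}$, is nonseparable. $\mathrm{Borel}(E^*,w^* )$ is the Borel $\sigma$-algebra of the weak$^*$ topology of $E^*$. A function $f:T\to E^*$ is weakly$^*$ scalarly measurable if $\langle f(\cdot),x\rangle$ is measurable for every $x\in E$ (for separable $E$ this is the same as measurability with respect to $\mathrm{Borel}(E^*,w^* )$). It is Gelfand integrable over $A\in\Sigma$ if it is weakly$^*$ scalarly measurable and there is $x_A^*\in E^*$ with $\langle x_A^*,x\rangle=\int_A\langle f(t),x\rangle d\mu$ for every $x\in E$; then $\int_A f\,d\mu:=x_A^*$ is the Gelfand integral. A multifunction $\Gamma:T\twoheadrightarrow E^*$ is a set-valued map with nonempty values; $\mathrm{gph}\,\Gamma=\{(t,x^* )\in T\times E^*: x^*\in\Gamma(t)\}$. It is integrably bounded if there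 is $\varphi\in L^1(\mu)$ with $\sup_{x^*\in\Gamma(t)}\|x^*\|\le\varphi(t)$ for every $t\in T$. $\overline{\mathrm{co}}^{\,w^*}\Gamma(t)$ is the weakly$^*$ closed convex hull of $\Gamma(t)$, and $\mathrm{ex}\,\overline{\mathrm{co}}^{\,w^*}\Gamma(t)$ is the set of its extreme points. A selector of $\Gamma$ is a function $f:T\to E^*$ with $f(t)\in\Gamma(t)$ a.e. The Gelfand integral of a multifunction is $\int_T\Gamma(t)d\mu=\{\int_T f\,d\mu : f \text{ a Gelfand integrable selector of }\Gamma\}$. *)

theory Defs
  imports "HOL-Analysis.Analysis"
begin

text \<open>
  The norm dual of a real Banach space \<open>'e\<close> is the type \<open>'e \<Rightarrow>\<^sub>L real\<close> with the operator norm.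
  The strong operator topology on \<open>'e \<Rightarrow>\<^sub>L real\<close> is pointwise convergence on \<open>'e\<close>, that is, the
  weak* topology.
\<close>

abbreviation weak_star :: "('e::real_normed_vector \<Rightarrow>\<^sub>L real) topology" where
  "weak_star \<equiv> strong_operator_topology"

definition weak_star_borel :: "('e::real_normed_vector \<Rightarrow>\<^sub>L real) measure" where
  "weak_star_borel = sigma UNIV {U. openin weak_star U}"

definition weak_star_closed_hull ::
    "('e::real_normed_vector \<Rightarrow>\<^sub>L real) set \<Rightarrow> ('e \<Rightarrow>\<^sub>L real) set" where
  "weak_star_closed_hull S = weak_star closure_of (convex hull S)"

definition extreme_points :: "'v::real_vector set \<Rightarrow> 'v set" where
  "extreme_points S = {x. x extreme_point_of S}"


text \<open>
  \<open>L1_topology M\<close> is the topology of the \<open>L\<^sup>1\<close>-seminorm on the integrable functions themselves; functions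
  agreeing almost everywhere are not identified. The passage to almost-everywhere classes
  is the Kolmogorov quotient, which does not affect separability.
\<close>

definition L1_topology :: "'a measure \<Rightarrow> ('a \<Rightarrow> real) topology" where
  "L1_topology M = topology (\<lambda>U. U \<subseteq> {f. integrable M f} \<and>
     (\<forall>f\<in>U. \<exists>e>0. {g. integrable M g \<and> (\<integral>t. \<bar>f t - g t\<bar> \<partial>M) < e} \<subseteq> U))"

lemma openin_L1_topology:
  fixes M :: "'a measure"
  shows "openin (L1_topology M) U \<longleftrightarrow> U \<subseteq> {f. integrable M f} \<and>
     (\<forall>f\<in>U. \<exists>e>0. {g. integrable M g \<and> (\<integral>t. \<bar>f t - g t\<bar> \<partial>M) < e} \<subseteq> U)"
proof -
  let ?P = "\<lambda>U :: ('a \<Rightarrow> real) set. U \<subseteq> {f. integrable M f} \<and>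
     (\<forall>f\<in>U. \<exists>e>0. {g. integrable M g \<and> (\<integral>t. \<bar>f t - g t\<bar> \<partial>M) < e} \<subseteq> U)"
  have "istopology ?P"
    unfolding istopology_def
  proof (intro conjI allI impI)
    fix S T assume S: "?P S" and T: "?P T"
    show "S \<inter> T \<subseteq> {f. integrable M f}" using S by auto
    show "\<forall>f\<in>S \<inter> T. \<exists>e>0. {g. integrable M g \<and> (\<integral>t. \<bar>f t - g t\<bar> \<partial>M) < e} \<subseteq> S \<inter> T"
    proof
      fix f assume "f \<in> S \<inter> T"
      then have fS: "f \<in> S" and fT: "f \<in> T" by auto
      obtain d where "d > 0" "{g. integrable M g \<and> (\<integral>t. \<bar>f t - g t\<bar> \<partial>M) < d} \<subseteq> S"
        using bspec[OF conjunct2[OF S] fS] by (elim exE conjE)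
      moreover obtain e where "e > 0" "{g. integrable M g \<and> (\<integral>t. \<bar>f t - g t\<bar> \<partial>M) < e} \<subseteq> T"
        using bspec[OF conjunct2[OF T] fT] by (elim exE conjE)
      ultimately show "\<exists>e>0. {g. integrable M g \<and> (\<integral>t. \<bar>f t - g t\<bar> \<partial>M) < e} \<subseteq> S \<inter> T"
        by (intro exI[of _ "min d e"]) auto
    qed
  next
    fix K assume K: "\<forall>S\<in>K. ?P S"
    show "\<Union>K \<subseteq> {f. integrable M f}" using K by blast
    show "\<forall>f\<in>\<Union>K. \<exists>e>0. {g. integrable M g \<and> (\<integral>t. \<bar>f t - g t\<bar> \<partial>M) < e} \<subseteq> \<Union>K"
    proof
      fix f assume "f \<in> \<Union>K"
      then obtain S where S: "S \<in> K" "f \<in> S" by blast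
      obtain e where "e > 0" "{g. integrable M g \<and> (\<integral>t. \<bar>f t - g t\<bar> \<partial>M) < e} \<subseteq> S"
        using bspec[OF conjunct2[OF bspec[OF K S(1)]] S(2)] by (elim exE conjE)
      then show "\<exists>e>0. {g. integrable M g \<and> (\<integral>t. \<bar>f t - g t\<bar> \<partial>M) < e} \<subseteq> \<Union>K"
        using S(1) by (intro exI[of _ e]) (simp, blast)
    qed
  qed
  then show ?thesis
    unfolding L1_topology_def by (simp add: topology_inverse')
qed

lemma topspace_L1_topology: "topspace (L1_topology M) = {f. integrable M f}"
proof
  show "topspace (L1_topology M) \<subseteq> {f. integrable M f}"
    unfolding topspace_def by (auto simp: openin_L1_topology)
  have "openin (L1_topology M) {f. integrable M f}"
    unfolding openin_L1_topology by (auto intro: exI[of _ 1])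
  then show "{f. integrable M f} \<subseteq> topspace (L1_topology M)"
    by (rule openin_subset)
qed

lemma openin_L1_ball:
  assumes f: "integrable M f"
  shows "openin (L1_topology M) {g. integrable M g \<and> (\<integral>t. \<bar>f t - g t\<bar> \<partial>M) < e}"
  unfolding openin_L1_topology
proof (intro conjI ballI)
  fix g assume "g \<in> {g. integrable M g \<and> (\<integral>t. \<bar>f t - g t\<bar> \<partial>M) < e}"
  then have g: "integrable M g" and less: "(\<integral>t. \<bar>f t - g t\<bar> \<partial>M) < e" by auto
  have "(\<integral>t. \<bar>f t - h t\<bar> \<partial>M) \<le> (\<integral>t. \<bar>f t - g t\<bar> \<partial>M) + (\<integral>t. \<bar>g t - h t\<bar> \<partial>M)"
    if h: "integrable M h" for h
  proof -
    have "(\<integral>t. \<bar>f t - h t\<bar> \<partial>M) \<le> (\<integral>t. \<bar>f t - g t\<bar> + \<bar>g t - h t\<bar> \<partial>M)"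
      using f g h by (intro integral_mono) auto
    also have "\<dots> = (\<integral>t. \<bar>f t - g t\<bar> \<partial>M) + (\<integral>t. \<bar>g t - h t\<bar> \<partial>M)"
      using f g h by (intro Bochner_Integration.integral_add) auto
    finally show ?thesis .
  qed
  then have "{h. integrable M h \<and> (\<integral>t. \<bar>g t - h t\<bar> \<partial>M) < e - (\<integral>t. \<bar>f t - g t\<bar> \<partial>M)}
      \<subseteq> {h. integrable M h \<and> (\<integral>t. \<bar>f t - h t\<bar> \<partial>M) < e}"
    by (intro Collect_mono) (smt (verit, best))
  then show "\<exists>d>0. {h. integrable M h \<and> (\<integral>t. \<bar>g t - h t\<bar> \<partial>M) < d}
      \<subseteq> {h. integrable M h \<and> (\<integral>t. \<bar>f t - h t\<bar> \<partial>M) < e}"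
    using less by (intro exI[of _ "e - (\<integral>t. \<bar>f t - g t\<bar> \<partial>M)"]) simp
qed auto

definition saturated_measure :: "'a measure \<Rightarrow> bool" where
  "saturated_measure M \<longleftrightarrow>
     (\<forall>S\<in>sets M. measure M S > 0 \<longrightarrow> \<not> separable_space (L1_topology (restrict_space M S)))"


definition weak_star_scalarly_measurable ::
    "'a measure \<Rightarrow> ('a \<Rightarrow> ('e::real_normed_vector \<Rightarrow>\<^sub>L real)) \<Rightarrow> bool" where
  "weak_star_scalarly_measurable M f \<longleftrightarrow>
     (\<forall>x. (\<lambda>t. blinfun_apply (f t) x) \<in> borel_measurable M)"

text \<open>
  Integrability of the scalar functions is part of the definition: the Bochner integral of a
  non-integrable function is 0 in HOL-Analysis.
\<close>

definition has_gelfand_integral ::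
    "'a measure \<Rightarrow> 'a set \<Rightarrow> ('a \<Rightarrow> ('e::real_normed_vector \<Rightarrow>\<^sub>L real)) \<Rightarrow> ('e \<Rightarrow>\<^sub>L real) \<Rightarrow> bool" where
  "has_gelfand_integral M A f v \<longleftrightarrow>
     weak_star_scalarly_measurable M f \<and>
     (\<forall>x. set_integrable M A (\<lambda>t. blinfun_apply (f t) x) \<and>
          blinfun_apply v x = (LINT t:A|M. blinfun_apply (f t) x))"

definition gelfand_integrable ::
    "'a measure \<Rightarrow> 'a set \<Rightarrow> ('a \<Rightarrow> ('e::real_normed_vector \<Rightarrow>\<^sub>L real)) \<Rightarrow> bool" where
  "gelfand_integrable M A f \<longleftrightarrow> (\<exists>v. has_gelfand_integral M A f v)"

definition gelfand_integral ::
    "'a measure \<Rightarrow> 'a set \<Rightarrow> ('a \<Rightarrow> ('e::real_normed_vector \<Rightarrow>\<^sub>L real)) \<Rightarrow> ('e \<Rightarrow>\<^sub>L real)" where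
  "gelfand_integral M A f = (THE v. has_gelfand_integral M A f v)"

lemma gelfand_integral_eq:
  assumes "has_gelfand_integral M A f v"
  shows "gelfand_integral M A f = v"
  unfolding gelfand_integral_def
  using assms by (intro the_equality) (auto simp: has_gelfand_integral_def intro: blinfun_eqI)


text \<open>
  A multifunction on \<open>space M\<close> is a set-valued function on the type \<open>'a\<close> of which only the
  values at points of \<open>space M\<close> matter.
\<close>

definition multifunction :: "'a measure \<Rightarrow> ('a \<Rightarrow> 'v set) \<Rightarrow> bool" where
  "multifunction M \<Gamma> \<longleftrightarrow> (\<forall>t\<in>space M. \<Gamma> t \<noteq> {})"

definition graph :: "'a measure \<Rightarrow> ('a \<Rightarrow> 'v set) \<Rightarrow> ('a \<times> 'v) set" where
  "graph M \<Gamma> = {(t, x). t \<in> space M \<and> x \<in> \<Gamma> t}"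

definition integrably_bounded :: "'a measure \<Rightarrow> ('a \<Rightarrow> 'v::real_normed_vector set) \<Rightarrow> bool" where
  "integrably_bounded M \<Gamma> \<longleftrightarrow>
     (\<exists>\<phi>::'a \<Rightarrow> real. integrable M \<phi> \<and> (\<forall>t\<in>space M. \<forall>x\<in>\<Gamma> t. norm x \<le> \<phi> t))"

definition selector :: "'a measure \<Rightarrow> ('a \<Rightarrow> 'v set) \<Rightarrow> ('a \<Rightarrow> 'v) \<Rightarrow> bool" where
  "selector M \<Gamma> f \<longleftrightarrow> (AE t in M. f t \<in> \<Gamma> t)"

definition multifunction_integral ::
    "'a measure \<Rightarrow> ('a \<Rightarrow> ('e::real_normed_vector \<Rightarrow>\<^sub>L real) set) \<Rightarrow> ('e \<Rightarrow>\<^sub>L real) set" where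
  "multifunction_integral M \<Gamma> =
     {gelfand_integral M (space M) f | f. gelfand_integrable M (space M) f \<and> selector M \<Gamma> f}"

end

theory Submission
  imports Defs
begin

text \<open>
  If \<open>L\<^sup>1\<close> over some \<open>S\<close> of positive measure is separable, let \<open>g\<^sub>n\<close> be truncations to
  \<open>[-1, 1]\<close> of a dense sequence of functions on \<open>S\<close>, with \<open>g\<^sub>0 = 1\<^sub>S\<close> put in front, and let
  \<open>(z\<^sub>n, w\<^sub>n)\<close> be a biorthogonal system in \<open>E \<times> E\<^sup>*\<close> with \<open>w\<close> absolutely summable. Put
  \<open>F = \<Sum>g\<^sub>n w\<^sub>n\<close> and let \<open>\<Gamma> t\<close> be the segment \<open>[-F t, F t]\<close>. The zero function is a
  selector of \<open>\<Gamma>\<close>. A selector \<open>f\<close> of the end points of the segments is of the form \<open>s F\<close> with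
  \<open>\<bar>s\<bar> = 1\<close> on \<open>S\<close>; if its integral is zero, then evaluation at \<open>z\<^sub>n\<close> shows that \<open>s\<close> is orthogonal to
  each \<open>g\<^sub>n\<close>, which is impossible because some \<open>g\<^sub>n\<close> is close to \<open>s\<close> in \<open>L\<^sup>1\<close>.
\<close>

section \<open>Norming functionals\<close>

text \<open>
  A pointwise minimal sublinear functional \<open>m\<close> is linear: for each \<open>y\<close> it equals its own lowering
  in the direction \<open>y\<close> (\<open>sublinear_lower_direction\<close>), so that \<open>m x \<le> m (x + y) - m y\<close>. Lowering the
  norm in the direction \<open>x\<close> first makes the functional take the value \<open>norm x\<close> at \<open>x\<close>.
\<close>

definition sublinear :: "('a::real_vector \<Rightarrow> real) \<Rightarrow> bool" where
  "sublinear p \<longleftrightarrow> (\<forall>x y. p (x + y) \<le> p x + p y) \<and> (\<forall>c>0. \<forall>x. p (c *\<^sub>R x) = c * p x)"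

text \<open>The inequality for \<open>c\<close> implies equality: applied to
  \<open>inverse c\<close> and \<open>c *\<^sub>R x\<close>, it gives the reverse
  inequality.\<close>

lemma sublinearI:
  assumes add: "\<And>x y. p (x + y) \<le> p x + p y"
    and scale: "\<And>c x. c > 0 \<Longrightarrow> p (c *\<^sub>R x) \<le> c * p x"
  shows "sublinear p"
proof -
  have "c * p x \<le> p (c *\<^sub>R x)" if "c > 0" for c x
    using scale[of "inverse c" "c *\<^sub>R x"] that by (simp add: field_simps)
  with assms show ?thesis
    by (auto simp: sublinear_def intro: antisym)
qed

lemma sublinear_add: "sublinear p \<Longrightarrow> p (x + y) \<le> p x + p y"
  and sublinear_scale: "sublinear p \<Longrightarrow> c > 0 \<Longrightarrow> p (c *\<^sub>R x) = c * p x"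
  by (auto simp: sublinear_def)

lemma sublinear_0: "sublinear p \<Longrightarrow> p 0 = 0"
  using sublinear_scale[of p 2 0] by simp

lemma sublinear_minus_ge: "sublinear p \<Longrightarrow> - p (- x) \<le> p x"
  using sublinear_add[of p x "- x"] sublinear_0[of p] by simp

lemma sublinear_lower_direction:
  fixes p :: "'a::real_vector \<Rightarrow> real"
  assumes p: "sublinear p"
  obtains q where "sublinear q" "\<And>x. q x \<le> p x" "\<And>x. q x \<le> p (x + y) - p y"
proof -
  \<comment> \<open>At \<open>t = 0\<close> and \<open>t = 1\<close> this expression is
    \<open>p x\<close> and \<open>p (x + y) - p y\<close>, so its infimum over
    \<open>t \<ge> 0\<close> satisfies both required bounds. The infimum stays sublinear because the
    parameters \<open>t\<close> add and scale along with the arguments.\<close>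
  define h where "h x t = p (x + t *\<^sub>R y) - t * p y" for x and t :: real
  define q where "q x = (INF t\<in>{0..}. h x t)" for x
  have bdd: "bdd_below (h x ` {0..})" for x
  proof (rule bdd_belowI2)
    fix t :: real assume "t \<in> {0..}"
    then have "p (t *\<^sub>R y) = t * p y"
      using sublinear_scale[OF p, of t y] sublinear_0[OF p] by (cases "t = 0") auto
    then show "- p (- x) \<le> h x t"
      using sublinear_add[OF p, of "- x" "x + t *\<^sub>R y"] by (simp add: h_def)
  qed
  have q_le: "q x \<le> h x t" if "t \<ge> 0" for x t
    unfolding q_def using that by (intro cINF_lower bdd) auto
  have q_ge: "c \<le> q x" if "\<And>t. t \<ge> 0 \<Longrightarrow> c \<le> h x t" for c x
    unfolding q_def using that by (intro cINF_greatest) auto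
  have "sublinear q"
  proof (rule sublinearI)
    fix x x'
    have "q (x + x') \<le> h x t + h x' t'" if "t \<ge> 0" "t' \<ge> 0" for t t'
    proof -
      have "q (x + x') \<le> h (x + x') (t + t')"
        using that by (intro q_le) auto
      also have "\<dots> \<le> h x t + h x' t'"
        using sublinear_add[OF p, of "x + t *\<^sub>R y" "x' + t' *\<^sub>R y"]
        by (simp add: h_def algebra_simps)
      finally show ?thesis .
    qed
    then have "q (x + x') - h x' t' \<le> q x" if "t' \<ge> 0" for t'
      using that by (intro q_ge) (simp add: algebra_simps)
    then have "q (x + x') - q x \<le> q x'"
      by (intro q_ge) (simp add: algebra_simps)
    then show "q (x + x') \<le> q x + q x'"
      by simp
  next
    fix c :: real and x assume c: "c > 0"
    have "q (c *\<^sub>R x) / c \<le> q x"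
    proof (rule q_ge)
      fix t :: real assume "t \<ge> 0"
      then have "q (c *\<^sub>R x) \<le> h (c *\<^sub>R x) (c * t)"
        using c by (intro q_le) auto
      also have "\<dots> = c * h x t"
        using sublinear_scale[OF p c, of "x + t *\<^sub>R y"] by (simp add: h_def algebra_simps)
      finally show "q (c *\<^sub>R x) / c \<le> h x t"
        using c by (simp add: field_simps)
    qed
    then show "q (c *\<^sub>R x) \<le> c * q x"
      using c by (simp add: field_simps)
  qed
  moreover have "q x \<le> p x" "q x \<le> p (x + y) - p y" for x
    using q_le[of 0 x] q_le[of 1 x] by (auto simp: h_def)
  ultimately show ?thesis
    using that by blast
qed

text \<open>The pointwise infimum is finite because every member is at least
  \<open>- p (- x)\<close> at \<open>x\<close>. Subadditivity is where the chain condition enters: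
  of two members one lies below the other, so a single member can be used for both summands.\<close>

lemma sublinear_chain_lower_bound:
  fixes p :: "'a::real_vector \<Rightarrow> real"
  assumes C: "C \<noteq> {}" "\<And>q. q \<in> C \<Longrightarrow> sublinear q" "\<And>q. q \<in> C \<Longrightarrow> q \<le> p"
    and chain: "\<And>q r. q \<in> C \<Longrightarrow> r \<in> C \<Longrightarrow> q \<le> r \<or> r \<le> q"
  obtains u where "sublinear u" "\<And>q. q \<in> C \<Longrightarrow> u \<le> q"
proof -
  define u where "u x = (INF q\<in>C. q x)" for x
  have bdd: "bdd_below ((\<lambda>q. q x) ` C)" for x
  proof (rule bdd_belowI2)
    fix q assume q: "q \<in> C"
    then show "- p (- x) \<le> q x"
      using sublinear_minus_ge[of q x] C(2,3)[of q] le_funD[of q p "- x"] by force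
  qed
  have u_le: "u x \<le> q x" if "q \<in> C" for q x
    unfolding u_def using that by (intro cINF_lower bdd)
  have u_ge: "c \<le> u x" if "\<And>q. q \<in> C \<Longrightarrow> c \<le> q x" for c x
    unfolding u_def using that C(1) by (intro cINF_greatest) auto
  have "sublinear u"
  proof (rule sublinearI)
    fix x y
    have "u (x + y) \<le> q x + r y" if qr: "q \<in> C" "r \<in> C" for q r
    proof -
      obtain m where m: "m \<in> C" "m \<le> q" "m \<le> r"
        using chain[OF qr] qr by blast
      have "u (x + y) \<le> m x + m y"
        using u_le[OF m(1), of "x + y"] sublinear_add[OF C(2)[OF m(1)], of x y] by linarith
      also have "\<dots> \<le> q x + r y"
        using m by (intro add_mono) (auto simp: le_fun_def)
      finally show ?thesis .
    qed
    then have "u (x + y) - r y \<le> u x" if "r \<in> C" for r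
      using that by (intro u_ge) (simp add: algebra_simps)
    then have "u (x + y) - u x \<le> u y"
      by (intro u_ge) (simp add: algebra_simps)
    then show "u (x + y) \<le> u x + u y"
      by simp
  next
    fix c :: real and x assume c: "c > 0"
    have "u (c *\<^sub>R x) / c \<le> u x"
    proof (rule u_ge)
      fix q assume q: "q \<in> C"
      show "u (c *\<^sub>R x) / c \<le> q x"
        using u_le[OF q, of "c *\<^sub>R x"] sublinear_scale[OF C(2)[OF q] c, of x] c
        by (simp add: field_simps)
    qed
    then show "u (c *\<^sub>R x) \<le> c * u x"
      using c by (simp add: field_simps)
  qed
  then show ?thesis
    using that u_le by (auto simp: le_fun_def)
qed

lemma linear_below_sublinear:
  fixes p :: "'a::real_vector \<Rightarrow> real"
  assumes p: "sublinear p"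
  obtains f where "linear f" "f \<le> p"
proof -
  define A where "A = {q. sublinear q \<and> q \<le> p}"
  \<comment> \<open>The order is reversed because Zorn's lemma produces maximal elements and a
    minimal functional is wanted.\<close>
  define R where "R = (\<lambda>q r :: 'a \<Rightarrow> real. r \<le> q)"
  have "\<exists>m\<in>A. \<forall>a\<in>A. R m a \<longrightarrow> a = m"
  proof (rule predicate_Zorn)
    show "partial_order_on A (relation_of R A)"
      by (rule partial_order_on_relation_ofI) (auto simp: R_def)
    fix C assume C: "C \<in> Chains (relation_of R A)"
    then have sub: "C \<subseteq> A" and chain: "\<And>q r. q \<in> C \<Longrightarrow> r \<in> C \<Longrightarrow> q \<le> r \<or> r \<le> q"
      unfolding Chains_def relation_of_def R_def by auto
    show "\<exists>u\<in>A. \<forall>a\<in>C. R a u"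
    proof (cases "C = {}")
      case True
      then show ?thesis
        using p by (auto simp: A_def)
    next
      case False
      obtain u where u: "sublinear u" "\<And>q. q \<in> C \<Longrightarrow> u \<le> q"
        using sublinear_chain_lower_bound[of C p] False sub chain by (auto simp: A_def)
      moreover have "u \<le> p"
        using False sub u(2) unfolding A_def
        by (metis (no_types, lifting) ex_in_conv mem_Collect_eq order_trans subsetD)
      ultimately show ?thesis
        by (auto simp: A_def R_def)
    qed
  qed
  then obtain m where m: "sublinear m" "m \<le> p"
    and minimal: "\<And>q. sublinear q \<Longrightarrow> q \<le> m \<Longrightarrow> q = m"
    unfolding A_def R_def by (smt (verit) mem_Collect_eq order_trans)
  have add: "m (x + y) = m x + m y" for x y
  proof (rule antisym)
    obtain q where q: "sublinear q" "\<And>x. q x \<le> m x" "\<And>x. q x \<le> m (x + y) - m y"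
      using sublinear_lower_direction[OF m(1)] by blast
    then have "q = m"
      by (intro minimal) (auto simp: le_fun_def)
    then show "m x + m y \<le> m (x + y)"
      using q(3)[of x] by simp
  qed (rule sublinear_add[OF m(1)])
  have minus: "m (- x) = - m x" for x
    using add[of x "- x"] sublinear_0[OF m(1)] by simp
  have scale: "m (c *\<^sub>R x) = c * m x" for c x
  proof (cases c "0 :: real" rule: linorder_cases)
    case less
    then show ?thesis
      using sublinear_scale[OF m(1), of "- c" x] minus[of "c *\<^sub>R x"] by simp
  qed (use sublinear_0 sublinear_scale m(1) in auto)
  have "linear m"
    using add scale by (intro linearI) auto
  with m(2) show ?thesis
    using that by blast
qed

lemma norming_functional:
  fixes x :: "'a::real_normed_vector"
  obtains f :: "'a \<Rightarrow>\<^sub>L real" where "blinfun_apply f x = norm x"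
proof -
  have "sublinear (norm :: 'a \<Rightarrow> real)"
    by (rule sublinearI) (auto intro: norm_triangle_ineq)
  then obtain q :: "'a \<Rightarrow> real" where q: "sublinear q" "\<And>y. q y \<le> norm y"
      "\<And>y. q y \<le> norm (y + x) - norm x"
    using sublinear_lower_direction by blast
  obtain f where f: "linear f" "f \<le> q"
    using linear_below_sublinear[OF q(1)] by blast
  have le: "f y \<le> norm y" for y
    using order_trans[OF le_funD[OF f(2)] q(2)] .
  have "bounded_linear f"
  proof (rule bounded_linear_intro[where K = 1])
    show "norm (f y) \<le> norm y * 1" for y
      using le[of y] le[of "- y"] f(1) by (simp add: linear_neg abs_le_iff)
  qed (use f(1) in \<open>auto simp: linear_add linear_scale\<close>)
  moreover have "f x = norm x"
  proof (rule antisym)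
    \<comment> \<open>At \<open>- x\<close> the second bound on \<open>q\<close> reads
      \<open>norm 0 - norm x\<close>; linearity then turns the upper bound at \<open>- x\<close>
      into a lower bound at \<open>x\<close>.\<close>
    have "f (- x) \<le> - norm x"
      using order_trans[OF le_funD[OF f(2)] q(3)[of "- x"]] by simp
    then show "norm x \<le> f x"
      using f(1) by (simp add: linear_neg)
  qed (rule le)
  ultimately show ?thesis
    using that[of "Blinfun f"] by (simp add: bounded_linear_Blinfun_apply)
qed

section \<open>Biorthogonal systems with absolutely summable functionals\<close>

text \<open>A two-sided Gram-Schmidt recursion. Finitely many vectors never span the space, so a new
  vector exists outside their span; it is corrected to lie in the kernel of the earlier functionals,
  and a functional norming it is corrected to vanish on the earlier vectors.\<close>

lemma biorthogonal_system:
  assumes "\<not> (\<exists>B :: 'e set. finite B \<and> span B = UNIV)"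
  obtains e :: "nat \<Rightarrow> 'e::real_normed_vector" and f :: "nat \<Rightarrow> 'e \<Rightarrow>\<^sub>L real"
  where "\<And>m n. blinfun_apply (f n) (e m) = (if m = n then 1 else 0)"
proof -
  define P where "P h n r \<longleftrightarrow> blinfun_apply (snd r) (fst r) = 1 \<and>
      (\<forall>i<n. blinfun_apply (snd r) (fst (h i)) = 0 \<and> blinfun_apply (snd (h i)) (fst r) = 0)"
    for h :: "nat \<Rightarrow> 'e \<times> ('e \<Rightarrow>\<^sub>L real)" and n and r :: "'e \<times> ('e \<Rightarrow>\<^sub>L real)"
  have "\<exists>h. \<forall>n. P h n (h n)"
  proof (rule dependent_wellorder_choice)
    fix r and f g :: "nat \<Rightarrow> 'e \<times> ('e \<Rightarrow>\<^sub>L real)" and n :: nat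
    assume "\<And>y. y < n \<Longrightarrow> f y = g y"
    then show "P f n r = P g n r"
      by (auto simp: P_def)
  next
    fix n and h :: "nat \<Rightarrow> 'e \<times> ('e \<Rightarrow>\<^sub>L real)"
    assume "\<And>i. i < n \<Longrightarrow> P h i (h i)"
    then have bi: "blinfun_apply (snd (h j)) (fst (h i)) = (if i = j then 1 else 0)"
      if "i < n" "j < n" for i j
      using that by (cases i j rule: linorder_cases) (auto simp: P_def)
    have "span ((\<lambda>i. fst (h i)) ` {..<n}) \<noteq> UNIV"
      using assms by blast
    then obtain y where y: "y \<notin> span ((\<lambda>i. fst (h i)) ` {..<n})"
      by blast
    define x where "x = y - (\<Sum>i<n. blinfun_apply (snd (h i)) y *\<^sub>R fst (h i))"
    have "x \<noteq> 0"
    proof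
      assume "x = 0"
      then have "y = (\<Sum>i<n. blinfun_apply (snd (h i)) y *\<^sub>R fst (h i))"
        by (simp add: x_def)
      also have "\<dots> \<in> span ((\<lambda>i. fst (h i)) ` {..<n})"
        by (intro span_sum span_scale span_base) auto
      finally show False
        using y by blast
    qed
    have x_ker: "blinfun_apply (snd (h j)) x = 0" if "j < n" for j
      using that by (simp add: x_def blinfun.diff_right blinfun.sum_right blinfun.scaleR_right
          bi if_distrib sum.If_cases cong: if_cong)
    obtain u :: "'e \<Rightarrow>\<^sub>L real" where u: "blinfun_apply u x = norm x"
      using norming_functional by blast
    define v where "v = u /\<^sub>R norm x"
    \<comment> \<open>The subtracted functionals all vanish at \<open>x\<close>, so the correction
      keeps the value \<open>1\<close> there.\<close>
    define f where "f = v - (\<Sum>i<n. blinfun_apply v (fst (h i)) *\<^sub>R snd (h i))"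
    have "blinfun_apply f (fst (h j)) = 0" if "j < n" for j
      using that by (simp add: f_def blinfun.diff_left blinfun.sum_left blinfun.scaleR_left
          bi if_distrib sum.If_cases cong: if_cong)
    moreover have "blinfun_apply f x = 1"
      using \<open>x \<noteq> 0\<close> by (simp add: f_def v_def u x_ker blinfun.diff_left blinfun.sum_left
          blinfun.scaleR_left)
    ultimately have "P h n (x, f)"
      using x_ker by (simp add: P_def)
    then show "\<exists>r. P h n r"
      by blast
  qed
  then obtain h where "\<And>n. P h n (h n)"
    by blast
  then have "blinfun_apply (snd (h n)) (fst (h m)) = (if m = n then 1 else 0)" for m n
    by (cases m n rule: linorder_cases) (auto simp: P_def)
  then show ?thesis
    using that[of "\<lambda>n. snd (h n)" "\<lambda>n. fst (h n)"] by blast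
qed

text \<open>Multiplying each functional by \<open>c n > 0\<close> and dividing its vector by
  \<open>c n\<close> preserves biorthogonality, so the functionals can be made as small as
  desired.\<close>

lemma summable_biorthogonal_system:
  assumes "\<not> (\<exists>B :: 'e set. finite B \<and> span B = UNIV)"
  obtains z :: "nat \<Rightarrow> 'e::real_normed_vector" and w :: "nat \<Rightarrow> 'e \<Rightarrow>\<^sub>L real"
  where "summable (\<lambda>n. norm (w n))" "\<And>m n. blinfun_apply (w n) (z m) = (if m = n then 1 else 0)"
proof -
  obtain f :: "nat \<Rightarrow> 'e \<Rightarrow>\<^sub>L real" and e :: "nat \<Rightarrow> 'e"
    where ef: "\<And>m n. blinfun_apply (f n) (e m) = (if m = n then 1 else 0)"
    by (rule biorthogonal_system[OF assms]) (rule that)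
  define c where "c n = (1 / 2) ^ n / (1 + norm (f n))" for n
  have c: "c n > 0" for n
    unfolding c_def by (intro divide_pos_pos add_pos_nonneg) auto
  have "summable (\<lambda>n. norm (c n *\<^sub>R f n))"
  proof (rule summable_comparison_test)
    have "norm (c n *\<^sub>R f n) \<le> (1 / 2) ^ n" for n
    proof -
      have "norm (f n) / (1 + norm (f n)) \<le> 1"
        by (simp add: divide_le_eq add_pos_nonneg)
      then have "(1 / 2) ^ n * (norm (f n) / (1 + norm (f n))) \<le> (1 / 2) ^ n * 1"
        by (intro mult_left_mono) auto
      then show ?thesis
        using c[of n] by (simp add: c_def)
    qed
    then show "\<exists>N. \<forall>n\<ge>N. norm (norm (c n *\<^sub>R f n)) \<le> (1 / 2) ^ n"
      by simp
    show "summable (\<lambda>n. (1 / 2 :: real) ^ n)"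
      by (rule summable_geometric) auto
  qed
  moreover have "blinfun_apply (c n *\<^sub>R f n) (e m /\<^sub>R c m) = (if m = n then 1 else 0)" for m n
    using less_imp_neq[OF c[of n]] by (simp add: blinfun.scaleR_left blinfun.scaleR_right ef)
  ultimately show ?thesis
    by (rule that)
qed

section \<open>The segment multifunction\<close>

lemma extreme_point_of_symmetric_segment:
  fixes v x :: "'v::real_vector"
  assumes "x extreme_point_of closed_segment (- v) v"
  shows "x = v \<or> x = - v"
proof (rule ccontr)
  assume "\<not> (x = v \<or> x = - v)"
  moreover have "x \<in> closed_segment (- v) v"
    using assms by (simp add: extreme_point_of_def)
  ultimately have "x \<in> open_segment (- v) v"
    by (auto simp: open_segment_def)
  then show False
    using assms by (auto simp: extreme_point_of_def)
qed

text \<open>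
  The evaluation at \<open>z\<close> recovers the coefficient, which turns membership in the segment into
  conditions that are continuous in \<open>v\<close>.
\<close>

lemma mem_symmetric_segment_iff:
  fixes u v :: "'e::real_normed_vector \<Rightarrow>\<^sub>L real"
  assumes u: "u = 0 \<or> blinfun_apply u z = 1"
  shows "v \<in> closed_segment (- u) u \<longleftrightarrow> \<bar>blinfun_apply v z\<bar> \<le> blinfun_apply u z \<and>
    (\<forall>x. blinfun_apply v x = blinfun_apply v z * blinfun_apply u x)"
proof
  assume "v \<in> closed_segment (- u) u"
  then obtain s where s: "0 \<le> s" "s \<le> 1" "v = (1 - s) *\<^sub>R (- u) + s *\<^sub>R u"
    by (auto simp: in_segment)
  then have "v = (2 * s - 1) *\<^sub>R u"
    by (simp add: algebra_simps flip: scaleR_add_left)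
  with u s(1,2) show "\<bar>blinfun_apply v z\<bar> \<le> blinfun_apply u z \<and>
      (\<forall>x. blinfun_apply v x = blinfun_apply v z * blinfun_apply u x)"
    by (auto simp: blinfun.scaleR_left abs_le_iff)
next
  assume *: "\<bar>blinfun_apply v z\<bar> \<le> blinfun_apply u z \<and>
      (\<forall>x. blinfun_apply v x = blinfun_apply v z * blinfun_apply u x)"
  define a where "a = blinfun_apply v z"
  have v: "v = a *\<^sub>R u"
    unfolding a_def
    by (rule blinfun_eqI) (unfold blinfun.scaleR_left real_scaleR_def, rule conjunct2[OF *, rule_format])
  have "\<bar>a\<bar> \<le> 1"
    using conjunct1[OF *] u unfolding a_def by auto
  moreover have "v = (1 - (1 + a) / 2) *\<^sub>R (- u) + ((1 + a) / 2) *\<^sub>R u"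
    by (simp add: v field_simps flip: scaleR_add_left scaleR_diff_left)
  ultimately show "v \<in> closed_segment (- u) u"
    by (auto simp: in_segment abs_le_iff intro!: exI[of _ "(1 + a) / 2"])
qed

lemma Hausdorff_space_weak_star:
  "Hausdorff_space (weak_star :: ('e::real_normed_vector \<Rightarrow>\<^sub>L real) topology)"
  unfolding Hausdorff_space_def
proof (intro allI impI)
  fix u v :: "'e \<Rightarrow>\<^sub>L real"
  assume "u \<in> topspace weak_star \<and> v \<in> topspace weak_star \<and> u \<noteq> v"
  then obtain x where "blinfun_apply u x \<noteq> blinfun_apply v x"
    using blinfun_eqI[of u v] by blast
  then obtain U V where UV: "open U" "open V" "blinfun_apply u x \<in> U" "blinfun_apply v x \<in> V"
      "U \<inter> V = {}"
    using hausdorff[of "blinfun_apply u x" "blinfun_apply v x"] by blast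
  have "openin weak_star {w. blinfun_apply w x \<in> W}" if "open W" for W :: "real set"
    using strong_operator_topology_basis[of "{x}" "\<lambda>_. W" "\<lambda>y. y"] that by simp
  with UV show "\<exists>U V. openin weak_star U \<and> openin weak_star V \<and> u \<in> U \<and> v \<in> V \<and> disjnt U V"
    by (intro exI[of _ "{w. blinfun_apply w x \<in> U}"] exI[of _ "{w. blinfun_apply w x \<in> V}"])
      (auto simp: disjnt_def)
qed

text \<open>The identity is continuous from the norm topology to the weak* topology, so norm compact
  sets are weak* compact, hence closed in a Hausdorff space.\<close>

lemma closedin_weak_star_compact:
  fixes K :: "('e::real_normed_vector \<Rightarrow>\<^sub>L real) set"
  assumes "compact K"
  shows "closedin weak_star K"
proof -
  have "compactin weak_star ((\<lambda>f. f) ` K)"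
    using assms
    by (intro image_compactin[OF _ strong_operator_topology_weaker_than_euclidean]) simp
  then show ?thesis
    using compactin_imp_closedin[OF Hausdorff_space_weak_star] by simp
qed

lemma weak_star_closed_hull_eq:
  "convex K \<Longrightarrow> closedin weak_star K \<Longrightarrow> weak_star_closed_hull K = K"
  unfolding weak_star_closed_hull_def by (metis closure_of_eq convex_hull_eq)

lemma measurable_weak_star_eval:
  "(\<lambda>v. blinfun_apply v x) \<in> borel_measurable (weak_star_borel :: ('e::real_normed_vector \<Rightarrow>\<^sub>L real) measure)"
proof (rule borel_measurableI)
  fix U :: "real set" assume "open U"
  then have "openin weak_star {v :: 'e \<Rightarrow>\<^sub>L real. blinfun_apply v x \<in> U}"
    using strong_operator_topology_basis[of "{x}" "\<lambda>_. U" "\<lambda>y. y"] by simp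
  then show "(\<lambda>v. blinfun_apply v x) -` U \<inter> space weak_star_borel
      \<in> sets (weak_star_borel :: ('e \<Rightarrow>\<^sub>L real) measure)"
    by (auto simp: weak_star_borel_def vimage_def intro: sigma_sets.Basic)
qed

lemma space_weak_star_borel [simp]: "space weak_star_borel = UNIV"
  by (simp add: weak_star_borel_def)

text \<open>Both sides of the proportionality condition are continuous in \<open>x\<close>, so it
  suffices to test it on a countable dense set. This leaves countably many jointly measurable
  conditions on the pair of point and functional.\<close>

lemma graph_symmetric_segment_measurable:
  fixes F :: "'a \<Rightarrow> 'e::real_normed_vector \<Rightarrow>\<^sub>L real"
  assumes separable: "separable_space (euclidean :: 'e topology)"
    and F: "weak_star_scalarly_measurable M F"
    and z: "\<And>t. F t = 0 \<or> blinfun_apply (F t) z = 1"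
  shows "graph M (\<lambda>t. closed_segment (- F t) (F t)) \<in> sets (M \<Otimes>\<^sub>M weak_star_borel)"
proof -
  obtain D :: "'e set" where D: "countable D" "closure D = UNIV"
    using separable by (auto simp: separable_space_def)
  have dense: "(\<forall>x. blinfun_apply v x = blinfun_apply v z * blinfun_apply u x) \<longleftrightarrow>
      (\<forall>x\<in>D. blinfun_apply v x = blinfun_apply v z * blinfun_apply u x)" for u v :: "'e \<Rightarrow>\<^sub>L real"
  proof
    assume *: "\<forall>x\<in>D. blinfun_apply v x = blinfun_apply v z * blinfun_apply u x"
    have "closed {x. blinfun_apply v x = blinfun_apply v z * blinfun_apply u x}"
      by (intro closed_Collect_eq continuous_intros)
    moreover have "D \<subseteq> {x. blinfun_apply v x = blinfun_apply v z * blinfun_apply u x}"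
      using * by blast
    ultimately have "closure D \<subseteq> {x. blinfun_apply v x = blinfun_apply v z * blinfun_apply u x}"
      by (rule closure_minimal[rotated])
    then show "\<forall>x. blinfun_apply v x = blinfun_apply v z * blinfun_apply u x"
      using D(2) by blast
  qed blast
  have [measurable]: "(\<lambda>t. blinfun_apply (F t) x) \<in> borel_measurable M" for x
    using F by (simp add: weak_star_scalarly_measurable_def)
  note [measurable] = measurable_weak_star_eval D(1)
  have "graph M (\<lambda>t. closed_segment (- F t) (F t)) =
      {p \<in> space (M \<Otimes>\<^sub>M weak_star_borel).
        \<bar>blinfun_apply (snd p) z\<bar> \<le> blinfun_apply (F (fst p)) z \<and>
        (\<forall>x\<in>D. blinfun_apply (snd p) x = blinfun_apply (snd p) z * blinfun_apply (F (fst p)) x)}"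
    using mem_symmetric_segment_iff[OF z] dense by (auto simp: graph_def space_pair_measure)
  also have "\<dots> \<in> sets (M \<Otimes>\<^sub>M weak_star_borel)"
    by measurable
  finally show ?thesis .
qed

text \<open>Zero is the midpoint of every segment, so the zero function is a selector.\<close>

lemma multifunction_integral_symmetric_segment:
  fixes F :: "'a \<Rightarrow> 'e::real_normed_vector \<Rightarrow>\<^sub>L real"
  shows "0 \<in> multifunction_integral M (\<lambda>t. closed_segment (- F t) (F t))"
proof -
  have "has_gelfand_integral M (space M) (\<lambda>_. 0 :: 'e \<Rightarrow>\<^sub>L real) 0"
    by (simp add: has_gelfand_integral_def weak_star_scalarly_measurable_def set_integrable_def
        set_lebesgue_integral_def)
  moreover have "selector M (\<lambda>t. closed_segment (- F t) (F t)) (\<lambda>_. 0)"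
    unfolding selector_def in_segment by (intro AE_I2 exI[of _ "1 / 2"]) simp
  ultimately show ?thesis
    unfolding multifunction_integral_def gelfand_integrable_def
    by (auto simp: gelfand_integral_eq intro!: exI[of _ "\<lambda>_. 0"])
qed

section \<open>Sums of bounded functions with summable coefficients\<close>

lemma summable_bounded_scaleR:
  fixes w :: "nat \<Rightarrow> 'v::banach"
  assumes w: "summable (\<lambda>n. norm (w n))" and a: "\<And>n. \<bar>a n\<bar> \<le> 1"
  shows "summable (\<lambda>n. norm (a n *\<^sub>R w n))"
    and "norm (\<Sum>n. a n *\<^sub>R w n) \<le> (\<Sum>n. norm (w n))"
proof -
  have le: "norm (a n *\<^sub>R w n) \<le> norm (w n)" for n
    using mult_right_mono[OF a[of n] norm_ge_zero[of "w n"]] by simp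
  then show s: "summable (\<lambda>n. norm (a n *\<^sub>R w n))"
    by (intro summable_comparison_test[OF _ w]) auto
  show "norm (\<Sum>n. a n *\<^sub>R w n) \<le> (\<Sum>n. norm (w n))"
    using summable_norm[OF s] suminf_le[OF le s w] by linarith
qed

lemma blinfun_apply_suminf:
  fixes w :: "nat \<Rightarrow> 'e::real_normed_vector \<Rightarrow>\<^sub>L real"
  assumes "summable (\<lambda>n. norm (a n *\<^sub>R w n))"
  shows "blinfun_apply (\<Sum>n. a n *\<^sub>R w n) x = (\<Sum>n. a n * blinfun_apply (w n) x)"
  using bounded_linear.suminf[OF blinfun.bounded_linear_left summable_norm_cancel[OF assms]]
  by (simp add: blinfun.scaleR_left)

section \<open>Separability of \<open>L\<^sup>1\<close>\<close>

text \<open>Truncation to \<open>[-1, 1]\<close> is nonexpansive and fixes the values of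
  \<open>s\<close>, so it does not worsen the approximation of \<open>s\<close>. The resulting
  uniform bound is what makes series with these coefficients converge.\<close>

lemma separable_L1_dense_bounded_sequence:
  fixes M :: "'a measure"
  assumes fin: "finite_measure M" and S: "S \<in> sets M"
    and sep: "separable_space (L1_topology (restrict_space M S))"
  obtains g :: "nat \<Rightarrow> 'a \<Rightarrow> real"
  where "\<And>n. g n \<in> borel_measurable M" "\<And>n t. \<bar>g n t\<bar> \<le> indicator S t"
    "\<And>s e. s \<in> borel_measurable M \<Longrightarrow> (\<And>t. \<bar>s t\<bar> \<le> indicator S t) \<Longrightarrow> e > 0 \<Longrightarrow>
      \<exists>n. (\<integral>t. \<bar>s t - g n t\<bar> \<partial>M) < e"
proof -
  interpret finite_measure M by fact
  let ?R = "restrict_space M S"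
  note [measurable] = S
  have S': "S \<inter> space M \<in> sets M"
    using S by simp
  obtain D where D: "countable D" "D \<subseteq> {f. integrable ?R f}"
      "L1_topology ?R closure_of D = {f. integrable ?R f}"
    using sep by (auto simp: separable_space_def topspace_L1_topology)
  \<comment> \<open>A dense set is nonempty, as \<open>from_nat_into\<close> requires in order to
    enumerate it.\<close>
  have "(\<lambda>_. 0) \<in> L1_topology ?R closure_of D"
    unfolding D(3) by simp
  then have "D \<noteq> {}"
    by auto
  define d where "d = from_nat_into D"
  have d: "integrable ?R (d n)" for n
    using from_nat_into[OF \<open>D \<noteq> {}\<close>] D(2) by (auto simp: d_def)
  \<comment> \<open>The values of \<open>d n\<close> off \<open>S\<close> are arbitrary; the
    indicator replaces them by zero before truncation.\<close>
  define g where "g n t = max (- 1) (min 1 (indicator S t *\<^sub>R d n t))" for n t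
  have g_meas: "g n \<in> borel_measurable M" for n
    using borel_measurable_integrable[OF d[of n]] S'
    unfolding borel_measurable_restrict_space_iff[OF S'] g_def by measurable
  have g_bound: "\<bar>g n t\<bar> \<le> indicator S t" for n t
    by (auto simp: g_def indicator_def)
  have "\<exists>n. (\<integral>t. \<bar>s t - g n t\<bar> \<partial>M) < e"
    if s: "s \<in> borel_measurable M" "\<And>t. \<bar>s t\<bar> \<le> indicator S t" and e: "e > 0" for s e
  proof -
    have int: "integrable M u"
      if "u \<in> borel_measurable M" "\<And>t. \<bar>u t\<bar> \<le> indicator S t" for u :: "'a \<Rightarrow> real"
      using that
      by (intro integrable_const_bound[where B = 1])
        (auto intro!: AE_I2 order_trans[OF _ indicator_le_1])
    have "(\<lambda>t. indicator S t *\<^sub>R s t) = s"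
    proof
      show "indicator S t *\<^sub>R s t = s t" for t
        using s(2)[of t] by (cases "t \<in> S") auto
    qed
    then have sR: "integrable ?R s"
      using int[OF s] by (simp only: integrable_restrict_space[OF S'])
    then have "s \<in> L1_topology ?R closure_of D"
      by (simp add: D(3))
    define B where "B = {h. integrable ?R h \<and> (\<integral>t. \<bar>s t - h t\<bar> \<partial>?R) < e}"
    have "s \<in> B" "openin (L1_topology ?R) B"
      using sR e openin_L1_ball[OF sR] by (simp_all add: B_def)
    with \<open>s \<in> L1_topology ?R closure_of D\<close> obtain h where "h \<in> D" "h \<in> B"
      unfolding in_closure_of by blast
    then have h: "h \<in> D" "(\<integral>t. \<bar>s t - h t\<bar> \<partial>?R) < e"
      by (simp_all add: B_def)
    obtain n where n: "d n = h"
      using from_nat_into_surj[OF D(1) h(1)] by (auto simp: d_def)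
    have "(\<integral>t. \<bar>s t - g n t\<bar> \<partial>M) \<le> (\<integral>t. indicator S t *\<^sub>R \<bar>s t - d n t\<bar> \<partial>M)"
    proof (rule integral_mono)
      show "integrable M (\<lambda>t. \<bar>s t - g n t\<bar>)"
        using int[OF s] int[OF g_meas g_bound] by auto
      show "integrable M (\<lambda>t. indicator S t *\<^sub>R \<bar>s t - d n t\<bar>)"
        using sR d[of n] by (subst integrable_restrict_space[OF S', symmetric]) auto
      show "\<bar>s t - g n t\<bar> \<le> indicator S t *\<^sub>R \<bar>s t - d n t\<bar>" for t
        using s(2)[of t] by (auto simp: g_def indicator_def split: if_splits)
    qed
    also have "\<dots> = (\<integral>t. \<bar>s t - h t\<bar> \<partial>?R)"
      by (simp add: integral_restrict_space[OF S'] n)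
    finally show ?thesis
      using h(2) by (intro exI[of _ n]) linarith
  qed
  with g_meas g_bound show ?thesis
    using that by blast
qed

text \<open>Choose \<open>g n\<close> closer to \<open>s\<close> in mean than
  \<open>measure M S\<close>. The integral of \<open>s * s\<close> is \<open>measure M S\<close>,
  and that of \<open>s * (s - g n)\<close> is strictly smaller, so the integral of
  \<open>s * g n\<close> is positive.\<close>

lemma unimodular_not_orthogonal_to_dense:
  fixes M :: "'a measure" and s :: "'a \<Rightarrow> real" and g :: "nat \<Rightarrow> 'a \<Rightarrow> real"
  assumes fin: "finite_measure M" and S: "S \<in> sets M" "measure M S > 0"
    and s: "s \<in> borel_measurable M" "AE t in M. \<bar>s t\<bar> = indicator S t"
    and g: "\<And>n. g n \<in> borel_measurable M" "\<And>n t. \<bar>g n t\<bar> \<le> indicator S t"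
    and dense: "\<And>r e. r \<in> borel_measurable M \<Longrightarrow> (\<And>t. \<bar>r t\<bar> \<le> indicator S t) \<Longrightarrow> e > 0 \<Longrightarrow>
      \<exists>n. (\<integral>t. \<bar>r t - g n t\<bar> \<partial>M) < e"
  obtains n where "(\<integral>t. s t * g n t \<partial>M) \<noteq> 0"
proof -
  interpret finite_measure M by fact
  note [measurable] = S(1) s(1) g(1)
  \<comment> \<open>\<open>dense\<close> asks for the bound at every point, while \<open>s\<close>
    satisfies it only almost everywhere; clipping repairs this and changes \<open>s\<close> only on
    a null set.\<close>
  define r where "r t = max (- indicator S t) (min (indicator S t) (s t))" for t
  have r_meas [measurable]: "r \<in> borel_measurable M"
    unfolding r_def using S(1) s(1)
    by (intro borel_measurable_max borel_measurable_min borel_measurable_uminus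
        borel_measurable_indicator)
  have r_bound: "\<bar>r t\<bar> \<le> indicator S t" for t
    by (auto simp: r_def indicator_def)
  have rs: "AE t in M. r t = s t"
    using s(2) by eventually_elim (auto simp: r_def)
  obtain n where n: "(\<integral>t. \<bar>r t - g n t\<bar> \<partial>M) < measure M S"
    using dense[OF r_meas r_bound S(2)] by blast
  have int: "integrable M u" if "u \<in> borel_measurable M" "\<And>t. \<bar>u t\<bar> \<le> B" for u :: "'a \<Rightarrow> real" and B
    using that by (intro integrable_const_bound[where B = B]) auto
  have b1: "\<bar>r t\<bar> \<le> 1" "\<bar>g n t\<bar> \<le> 1" for t
    using order_trans[OF r_bound indicator_le_1] order_trans[OF g(2) indicator_le_1] by auto
  have int_r: "integrable M r" "integrable M (g n)"
    using b1 by (auto intro!: int[where B = 1])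
  have b2: "\<bar>r t * y\<bar> \<le> 1" if "\<bar>y\<bar> \<le> 1" for t y
    using mult_mono[OF b1(1) that] by (simp add: abs_mult)
  have int_rg: "integrable M (\<lambda>t. r t * g n t)" "integrable M (\<lambda>t. r t * r t)"
    by (rule int[OF _ b2], measurable, rule b1)+
  have "measure M S = (\<integral>t. indicator S t \<partial>M)"
    using S(1) by simp
  also have "\<dots> = (\<integral>t. r t * r t \<partial>M)"
  proof (rule integral_cong_AE)
    show "AE t in M. indicator S t = r t * r t"
      using s(2) rs
    proof eventually_elim
      case (elim t)
      then show ?case
        by (cases "t \<in> S") (auto simp: abs_if split: if_splits)
    qed
  qed measurable
  finally have mS: "measure M S = (\<integral>t. r t * r t \<partial>M)" .
  have "(\<integral>t. r t * r t \<partial>M) - (\<integral>t. r t * g n t \<partial>M) = (\<integral>t. r t * (r t - g n t) \<partial>M)"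
    using int_rg by (simp add: right_diff_distrib)
  also have "\<dots> \<le> (\<integral>t. \<bar>r t - g n t\<bar> \<partial>M)"
  proof (rule integral_mono)
    show "integrable M (\<lambda>t. r t * (r t - g n t))"
      using int_rg by (simp add: right_diff_distrib)
    show "integrable M (\<lambda>t. \<bar>r t - g n t\<bar>)"
      using int_r by auto
    show "r t * (r t - g n t) \<le> \<bar>r t - g n t\<bar>" for t
    proof -
      have "\<bar>r t\<bar> * \<bar>r t - g n t\<bar> \<le> 1 * \<bar>r t - g n t\<bar>"
        by (intro mult_right_mono b1) simp
      then show ?thesis
        using abs_ge_self[of "r t * (r t - g n t)"] by (simp add: abs_mult)
    qed
  qed
  finally have "(\<integral>t. r t * g n t \<partial>M) \<noteq> 0"
    using mS n by linarith
  also have "(\<integral>t. r t * g n t \<partial>M) = (\<integral>t. s t * g n t \<partial>M)"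
    using rs by (intro integral_cong_AE) (auto elim: eventually_mono)
  finally show ?thesis
    using that by blast
qed

section \<open>A segment multifunction violating the integral identity when some L1 space is
  separable\<close>

theorem theorem3p2:
  fixes M :: "'a measure"
  assumes fin: "finite_measure M"
    and complete: "complete_measure M"
    and separable: "separable_space (euclidean :: 'e::banach topology)"
    and infinite_dim: "\<not> (\<exists>B::'e set. finite B \<and> span B = UNIV)"
    and ex_eq: "\<And>\<Gamma> :: 'a \<Rightarrow> ('e \<Rightarrow>\<^sub>L real) set.
           multifunction M \<Gamma> \<Longrightarrow>
           integrably_bounded M \<Gamma> \<Longrightarrow>
           (\<forall>t\<in>space M. closedin weak_star (\<Gamma> t)) \<Longrightarrow>
           graph M \<Gamma> \<in> sets (M \<Otimes>\<^sub>M weak_star_borel) \<Longrightarrow>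
           multifunction_integral M \<Gamma> =
             multifunction_integral M (\<lambda>t. extreme_points (weak_star_closed_hull (\<Gamma> t)))"
  shows "saturated_measure M"
proof (rule ccontr)
  interpret finite_measure M by fact
  assume "\<not> saturated_measure M"
  then obtain S where S: "S \<in> sets M" "measure M S > 0"
    and sep: "separable_space (L1_topology (restrict_space M S))"
    unfolding saturated_measure_def by blast
  obtain g :: "nat \<Rightarrow> 'a \<Rightarrow> real"
    where g: "\<And>n. g n \<in> borel_measurable M" "\<And>n t. \<bar>g n t\<bar> \<le> indicator S t"
      and dense: "\<And>s e. s \<in> borel_measurable M \<Longrightarrow> (\<And>t. \<bar>s t\<bar> \<le> indicator S t) \<Longrightarrow> e > 0 \<Longrightarrow>
        \<exists>n. (\<integral>t. \<bar>s t - g n t\<bar> \<partial>M) < e"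
    using separable_L1_dense_bounded_sequence[OF fin S(1) sep] by blast
  obtain w :: "nat \<Rightarrow> 'e \<Rightarrow>\<^sub>L real" and z :: "nat \<Rightarrow> 'e"
    where w: "summable (\<lambda>n. norm (w n))"
      and wz: "\<And>m n. blinfun_apply (w n) (z m) = (if m = n then 1 else 0)"
    by (rule summable_biorthogonal_system[OF infinite_dim]) (rule that)

  \<comment> \<open>Index 0 is reserved for the indicator of \<open>S\<close>, so that evaluation at
    \<open>z 0\<close> detects the sign on \<open>S\<close>; hence \<open>g n\<close> sits at index
    \<open>Suc n\<close>.\<close>
  define a where "a n = (case n of 0 \<Rightarrow> indicator S | Suc m \<Rightarrow> g m)" for n
  have a_meas: "a n \<in> borel_measurable M" for n
    using S(1) g(1) by (auto simp: a_def split: nat.split)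
  have a_ind: "\<bar>a n t\<bar> \<le> indicator S t" for n t
    using g(2) by (auto simp: a_def split: nat.split)
  then have a1: "\<bar>a n t\<bar> \<le> 1" for n t
    by (rule order_trans) (simp add: indicator_le_1)
  define F where "F t = (\<Sum>n. a n t *\<^sub>R w n)" for t
  have F_apply: "blinfun_apply (F t) x = (\<Sum>n. a n t * blinfun_apply (w n) x)" for t x
    unfolding F_def by (intro blinfun_apply_suminf summable_bounded_scaleR w a1)
  have F_z: "blinfun_apply (F t) (z m) = a m t" for t m
    using suminf_finite[of "{m}" "\<lambda>n. a n t * blinfun_apply (w n) (z m)"]
    by (simp add: F_apply wz)
  have F_cases: "F t = 0 \<or> blinfun_apply (F t) (z 0) = 1" for t
  proof (cases "t \<in> S")
    case False
    then have "a n t = 0" for n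
      using a_ind[of n t] by simp
    then show ?thesis
      by (simp add: F_def)
  qed (simp add: F_z a_def)
  have F_meas: "weak_star_scalarly_measurable M F"
    unfolding weak_star_scalarly_measurable_def F_apply
    by (intro allI borel_measurable_suminf borel_measurable_times a_meas) simp
  define \<Gamma> where "\<Gamma> t = closed_segment (- F t) (F t)" for t
  have closed: "closedin weak_star (\<Gamma> t)" for t
    unfolding \<Gamma>_def by (intro closedin_weak_star_compact) simp
  have "integrably_bounded M \<Gamma>"
    unfolding integrably_bounded_def
  proof (intro exI conjI ballI)
    fix t v assume "v \<in> \<Gamma> t"
    then have "norm v \<le> norm (F t)"
      \<comment> \<open>The ball of radius \<open>norm (F t)\<close> is convex and contains both end
        points.\<close>
      using closed_segment_subset[of "- F t" "cball 0 (norm (F t))" "F t"] by (auto simp: \<Gamma>_def)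
    also have "\<dots> \<le> (\<Sum>n. norm (w n))"
      unfolding F_def by (intro summable_bounded_scaleR w a1)
    finally show "norm v \<le> (\<Sum>n. norm (w n))" .
  qed simp
  then have "multifunction_integral M \<Gamma> =
      multifunction_integral M (\<lambda>t. extreme_points (weak_star_closed_hull (\<Gamma> t)))"
    using closed graph_symmetric_segment_measurable[OF separable F_meas F_cases]
    by (intro ex_eq) (auto simp: multifunction_def \<Gamma>_def[abs_def])
  moreover have "0 \<in> multifunction_integral M \<Gamma>"
    unfolding \<Gamma>_def[abs_def] by (rule multifunction_integral_symmetric_segment)
  moreover have "weak_star_closed_hull (\<Gamma> t) = \<Gamma> t" for t
    using closed by (intro weak_star_closed_hull_eq) (simp_all add: \<Gamma>_def)
  ultimately have "0 \<in> multifunction_integral M (\<lambda>t. extreme_points (\<Gamma> t))"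
    by simp
  then obtain f v where "gelfand_integral M (space M) f = 0" "has_gelfand_integral M (space M) f v"
    and sel: "AE t in M. f t \<in> extreme_points (\<Gamma> t)"
    unfolding multifunction_integral_def gelfand_integrable_def selector_def by auto
  \<comment> \<open>\<open>gelfand_integral\<close> is a definite description; uniqueness identifies
    the actual integral \<open>v\<close> with its value 0.\<close>
  then have f: "has_gelfand_integral M (space M) f 0"
    using gelfand_integral_eq by metis
  \<comment> \<open>On \<open>S\<close>, almost everywhere, this is the sign with which
    \<open>f t\<close> equals \<open>F t\<close> or \<open>- F t\<close>, because \<open>F t\<close>
    takes the value 1 at \<open>z 0\<close>; off \<open>S\<close> it vanishes almost
    everywhere.\<close>
  define s where "s t = blinfun_apply (f t) (z 0)" for t
  have fF: "AE t in M. f t = F t \<or> f t = - F t"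
    using sel by eventually_elim
      (auto simp: extreme_points_def \<Gamma>_def dest: extreme_point_of_symmetric_segment)
  have f_meas: "(\<lambda>t. blinfun_apply (f t) x) \<in> borel_measurable M" for x
    using f by (simp add: has_gelfand_integral_def weak_star_scalarly_measurable_def)
  have f_int: "(\<integral>t. blinfun_apply (f t) x \<partial>M) = 0" for x
  proof -
    have "(\<integral>t. blinfun_apply (f t) x \<partial>M) = (LINT t:space M|M. blinfun_apply (f t) x)"
      unfolding set_lebesgue_integral_def by (rule Bochner_Integration.integral_cong) auto
    also have "\<dots> = 0"
      using f by (simp add: has_gelfand_integral_def)
    finally show ?thesis .
  qed
  have s_meas: "s \<in> borel_measurable M"
    unfolding s_def by (rule f_meas)
  have "AE t in M. \<bar>s t\<bar> = indicator S t"
    using fF by eventually_elim (auto simp: s_def F_z a_def blinfun.minus_left)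
  then obtain n where n: "(\<integral>t. s t * g n t \<partial>M) \<noteq> 0"
    by (rule unimodular_not_orthogonal_to_dense[OF fin S s_meas _ g dense])
  \<comment> \<open>Evaluation at \<open>z (Suc n)\<close> reads off the coefficient
    \<open>g n\<close> of \<open>F\<close>, with the sign \<open>s\<close>. Since \<open>g n\<close>
    vanishes off \<open>S\<close>, the product has the right value there too. The right-hand
    integral is 0 by \<open>f_int\<close>, which gives the contradiction.\<close>
  have "(\<integral>t. s t * g n t \<partial>M) = (\<integral>t. blinfun_apply (f t) (z (Suc n)) \<partial>M)"
  proof (rule integral_cong_AE)
    show "AE t in M. s t * g n t = blinfun_apply (f t) (z (Suc n))"
      using fF
    proof eventually_elim
      case (elim t)
      have "indicator S t * g n t = g n t"
        using g(2)[of n t] by (auto simp: indicator_def split: if_splits)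
      with elim show ?case
        by (auto simp: s_def F_z a_def blinfun.minus_left)
    qed
  qed (use s_meas g(1) f_meas in measurable)
  with n f_int show False
    by simp
qed

end
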